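(* (Quadratic entropies.) Let $X\ne\{0\}$ be a real Hilbert space with inner product $\langle\cdot,\cdot\rangle$ and induced norm $\|\cdot\|$. Suppose that $A:X\to X$ is a continuous linear operator which is strongly monotone, i.e., there exists $\mu>0$ such that $\langle Ay-Ax,y-x\rangle\ge\mu\|x-y\|^2$ for all $x,y\in X$. Let $b:X\to\mathbb R$ be defined by $b(x):=\frac12\langle Ax,x\rangle$, $x\in X$. Then $b$ is strongly convex on $X$ with $\mu$ as a strong convexity parameter, and $b$ is a sequentially consistent Bregman function with zone $X$ which satisfies the limiting difference property; moreover, for all $y\in X$ and $\gamma\in\mathbb R$ the second type level-set $\{x\in X:B(x,y)\le\gamma\}$ is bounded.
   Context: For convex $b:X\to\mathbb R$, $b$ is strongly convex on $X$ with strong convexity parameter $\mu>0$ if $b(\lambda x+(1-\lambda)y)+\frac12\mu\lambda(1-\lambda)\|x-y\|^2\le\lambda b(x)+(1-\lambda)b(y)$ for all $\lambda\in(0,1)$, $x,y\in X$. Divergence: $B(x,y):=b(x)-b(y)-\langle b'(y),x-y\rangle$ for $x,y\in X$, where $b'(y)\in X^*$ is the Gâteaux derivative. A function $b:X\to\mathbb R$ (so $\mathrm{dom}(b)=X$) is a Bregman function with zone $X$ if: (i) $b$ is Gâteaux differentiable on $X$; (ii) $b$ is strictly convex and lower semicontinuous on $X$; (iii) for each $\gamma\in\mathbb R$ and $x\in X$ the set $\{y\in X:B(x,y)\le\gamma\}$ is bounded; (iv) if $\|x-y_i\|\to0$, then $B(x,y_i)\to0$; (v) if $(x_i)$ is a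 bounded sequence in $X$, $B(x_i,y_i)\to0$ and $\|y_i-y\|\to0$ for some $y\in X$, then $\|x_i-y\|\to0$. $b$ has the limiting difference property if for each $x\in X$ and each sequence $(y_i)$ in $X$ converging weakly to some $y\in X$, $B(x,y)=\lim_{i\to\infty}(B(x,y_i)-B(y,y_i))$. $b$ is sequentially consistent if for all sequences $(x_i),(y_i)$ in $X$ with $(y_i)$ bounded and $B(x_i,y_i)\to0$ one has $\|x_i-y_i\|\to0$. *)

theory Defs
  imports "HOL-Analysis.Analysis"
begin

text \<open>The dual space $X^*$ is the type \<open>'a \<Rightarrow>\<^sub>L real\<close> of bounded linear functionals.
  All functions considered are finite on the whole space, so the zone is always \<open>UNIV\<close>.\<close>

definition has_gateaux_derivative ::
    "('a::real_normed_vector \<Rightarrow> real) \<Rightarrow> ('a \<Rightarrow>\<^sub>L real) \<Rightarrow> 'a \<Rightarrow> bool"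
  where "has_gateaux_derivative b L x \<longleftrightarrow>
    (\<forall>h. ((\<lambda>t. (b (x + t *\<^sub>R h) - b x) / t) \<longlongrightarrow> blinfun_apply L h) (at 0))"

definition gateaux_differentiable :: "('a::real_normed_vector \<Rightarrow> real) \<Rightarrow> 'a \<Rightarrow> bool"
  where "gateaux_differentiable b x \<longleftrightarrow> (\<exists>L. has_gateaux_derivative b L x)"

text \<open>Unspecified when \<open>b\<close> is not Gateaux differentiable at \<open>x\<close>.\<close>
definition gateaux_derivative :: "('a::real_normed_vector \<Rightarrow> real) \<Rightarrow> 'a \<Rightarrow> ('a \<Rightarrow>\<^sub>L real)"
  where "gateaux_derivative b x = (THE L. has_gateaux_derivative b L x)"

definition divergence :: "('a::real_normed_vector \<Rightarrow> real) \<Rightarrow> 'a \<Rightarrow> 'a \<Rightarrow> real"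
  where "divergence b x y = b x - b y - blinfun_apply (gateaux_derivative b y) (x - y)"

definition strictly_convex :: "('a::real_vector \<Rightarrow> real) \<Rightarrow> bool"
  where "strictly_convex b \<longleftrightarrow>
    (\<forall>x y. \<forall>t\<in>{0<..<1}. x \<noteq> y \<longrightarrow>
      b (t *\<^sub>R x + (1 - t) *\<^sub>R y) < t * b x + (1 - t) * b y)"

definition strongly_convex :: "real \<Rightarrow> ('a::real_normed_vector \<Rightarrow> real) \<Rightarrow> bool"
  where "strongly_convex \<mu> b \<longleftrightarrow> \<mu> > 0 \<and> convex_on UNIV b \<and>
    (\<forall>x y. \<forall>t\<in>{0<..<1}.
      b (t *\<^sub>R x + (1 - t) *\<^sub>R y) + 1 / 2 * \<mu> * t * (1 - t) * (norm (x - y))\<^sup>2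
        \<le> t * b x + (1 - t) * b y)"

definition lower_semicontinuous :: "('a::topological_space \<Rightarrow> real) \<Rightarrow> bool"
  where "lower_semicontinuous b \<longleftrightarrow> (\<forall>x. \<forall>c < b x. \<forall>\<^sub>F y in nhds x. c < b y)"

definition weakly_tendsto :: "(nat \<Rightarrow> 'a::real_normed_vector) \<Rightarrow> 'a \<Rightarrow> bool"
  where "weakly_tendsto y l \<longleftrightarrow>
    (\<forall>f :: 'a \<Rightarrow>\<^sub>L real. (\<lambda>i. blinfun_apply f (y i)) \<longlonglongrightarrow> blinfun_apply f l)"

definition bregman_function :: "('a::real_normed_vector \<Rightarrow> real) \<Rightarrow> bool"
  where "bregman_function b \<longleftrightarrow>
    (\<forall>x. gateaux_differentiable b x) \<and>
    strictly_convex b \<and> lower_semicontinuous b \<and>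
    (\<forall>\<gamma> x. bounded {y. divergence b x y \<le> \<gamma>}) \<and>
    (\<forall>x y. (\<lambda>i::nat. norm (x - y i)) \<longlonglongrightarrow> 0 \<longrightarrow>
      (\<lambda>i. divergence b x (y i)) \<longlonglongrightarrow> 0) \<and>
    (\<forall>x y l. bounded (range (x :: nat \<Rightarrow> 'a)) \<longrightarrow>
      (\<lambda>i. divergence b (x i) (y i)) \<longlonglongrightarrow> 0 \<longrightarrow>
      (\<lambda>i. norm (y i - l)) \<longlonglongrightarrow> 0 \<longrightarrow>
      (\<lambda>i. norm (x i - l)) \<longlonglongrightarrow> 0)"

definition limiting_difference_property :: "('a::real_normed_vector \<Rightarrow> real) \<Rightarrow> bool"
  where "limiting_difference_property b \<longleftrightarrow>
    (\<forall>x y l. weakly_tendsto y l \<longrightarrow>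
      (\<lambda>i. divergence b x (y i) - divergence b l (y i)) \<longlonglongrightarrow> divergence b x l)"

definition sequentially_consistent :: "('a::real_normed_vector \<Rightarrow> real) \<Rightarrow> bool"
  where "sequentially_consistent b \<longleftrightarrow>
    (\<forall>x y. bounded (range (y :: nat \<Rightarrow> 'a)) \<longrightarrow>
      (\<lambda>i. divergence b (x i) (y i)) \<longlonglongrightarrow> 0 \<longrightarrow>
      (\<lambda>i. norm (x i - y i)) \<longlonglongrightarrow> 0)"

end

theory Submission
  imports Defs
begin

text \<open>A quadratic form \<open>b x = \<langle>A x, x\<rangle> / 2\<close> agrees with its second-order Taylor expansion, and the
  second-order term does not depend on the base point. Hence its Bregman divergence is
  translation invariant: \<open>B(x, y) = b (x - y)\<close>, even when \<open>A\<close> is not symmetric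
  (lemma \<open>divergence_eq\<close>). Strong monotonicity of \<open>A\<close> says precisely that
  \<open>b z \<ge> \<mu> / 2 * \<parallel>z\<parallel>\<^sup>2\<close>, so \<open>b\<close> dominates the squared norm. With these two facts every
  condition on \<open>B\<close> becomes a statement about the norm of \<open>x - y\<close>: sublevel sets in either
  argument lie in balls, and \<open>B(x\<^sub>i, y\<^sub>i) \<longlonglongrightarrow> 0\<close> forces
  \<open>\<parallel>x\<^sub>i - y\<^sub>i\<parallel> \<longlonglongrightarrow> 0\<close>. Convexity comes from the identity
  \<open>t b(x) + (1 - t) b(y) - b(t x + (1 - t) y) = t (1 - t) b(x - y)\<close>, and the
  limiting difference property from the fact that \<open>y \<mapsto> b'(y)(x - l)\<close> is itself a bounded
  linear functional, hence weakly continuous.\<close>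

section \<open>Uniqueness of the Gateaux derivative\<close>

lemma gateaux_derivative_eqI:
  assumes "has_gateaux_derivative b L x"
  shows "gateaux_derivative b x = L"
  unfolding gateaux_derivative_def
proof (rule the_equality[where P = "\<lambda>L. has_gateaux_derivative b L x", OF assms])
  fix M assume "has_gateaux_derivative b M x"
  then show "M = L"
    using assms unfolding has_gateaux_derivative_def
    by (intro blinfun_eqI) (blast intro: tendsto_unique[OF trivial_limit_at])
qed

section \<open>Quadratic forms of bounded operators\<close>

locale quadratic_form =
  fixes A :: "'a::real_inner \<Rightarrow> 'a" and b :: "'a \<Rightarrow> real"
  assumes bounded_linear_A: "bounded_linear A"
    and b_eq: "b x = 1 / 2 * inner (A x) x"
begin

lemmas A_add = linear_add[OF bounded_linear.linear[OF bounded_linear_A]]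
  and A_scale = linear_scale[OF bounded_linear.linear[OF bounded_linear_A]]

text \<open>The symmetrised bilinear form of \<open>A\<close>; its value at \<open>y\<close> and \<open>h\<close> is the derivative of \<open>b\<close>
  at \<open>y\<close> in the direction \<open>h\<close>.\<close>

definition polar :: "'a \<Rightarrow> 'a \<Rightarrow> real"
  where "polar y h = (inner (A y) h + inner (A h) y) / 2"

lemma polar_commute: "polar y h = polar h y"
  by (simp add: polar_def)

lemma bounded_linear_polar: "bounded_linear (polar y)"
proof -
  have "bounded_linear (\<lambda>h. (inner (A y) h + inner (A h) y) / 2)"
    by (intro bounded_linear_divide[THEN bounded_linear_compose] bounded_linear_add
        bounded_linear_inner_right
        bounded_linear_inner_left[THEN bounded_linear_compose] bounded_linear_A)
  then show ?thesis
    unfolding polar_def .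
qed

lemma b_scale: "b (t *\<^sub>R z) = t\<^sup>2 * b z"
  by (simp add: b_eq A_scale power2_eq_square)

lemma b_minus_commute: "b (x - y) = b (y - x)"
  using b_scale[of "-1" "x - y"] by simp

lemma b_add: "b (y + h) = b y + polar y h + b h"
  by (simp add: b_eq polar_def A_add inner_add_left inner_add_right algebra_simps
      add_divide_distrib)

lemma continuous_b: "isCont b x"
proof -
  have "isCont (\<lambda>x. 1 / 2 * inner (A x) x) x"
    by (intro continuous_intros linear_continuous_at bounded_linear_A)
  then show ?thesis
    by (simp add: b_eq[abs_def])
qed

lemma b_zero: "b 0 = 0"
  by (simp add: b_eq)

lemma has_gateaux_derivative_b: "has_gateaux_derivative b (Blinfun (polar y)) y"
  unfolding has_gateaux_derivative_def
proof
  fix h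
  have scale: "polar y (t *\<^sub>R h) = t * polar y h" for t
    using linear_scale[OF bounded_linear.linear[OF bounded_linear_polar]] by simp
  have "((\<lambda>t. polar y h + t * b h) \<longlongrightarrow> polar y h + 0 * b h) (at 0)"
    by (intro tendsto_intros)
  moreover have "\<forall>\<^sub>F t in at 0. polar y h + t * b h = (b (y + t *\<^sub>R h) - b y) / t"
    by (auto simp: eventually_at_filter b_add b_scale scale field_simps power2_eq_square)
  ultimately have "((\<lambda>t. (b (y + t *\<^sub>R h) - b y) / t) \<longlongrightarrow> polar y h) (at 0)"
    by (auto intro: Lim_transform_eventually)
  then show "((\<lambda>t. (b (y + t *\<^sub>R h) - b y) / t) \<longlongrightarrow> Blinfun (polar y) h) (at 0)"
    by (simp add: bounded_linear_Blinfun_apply[OF bounded_linear_polar])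
qed

lemma gateaux_derivative_b: "blinfun_apply (gateaux_derivative b y) = polar y"
  by (simp add: gateaux_derivative_eqI[OF has_gateaux_derivative_b]
      bounded_linear_Blinfun_apply[OF bounded_linear_polar])

text \<open>The divergence is the remainder of the first-order expansion of \<open>b\<close> at \<open>y\<close>, which for a
  quadratic form is its purely quadratic part, evaluated at the increment.\<close>

lemma divergence_eq: "divergence b x y = b (x - y)"
  using b_add[of y "x - y"] by (simp add: divergence_def gateaux_derivative_b)

text \<open>A quadratic polynomial in \<open>t\<close> lies below its chord by \<open>t (1 - t)\<close> times its
  leading coefficient; along the segment from \<open>y\<close> to \<open>x\<close> that coefficient is \<open>b (x - y)\<close>.\<close>

lemma convex_combination_gap:
  "b (t *\<^sub>R x + (1 - t) *\<^sub>R y) + t * (1 - t) * b (x - y) = t * b x + (1 - t) * b y"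
proof -
  have line: "t *\<^sub>R x + (1 - t) *\<^sub>R y = y + t *\<^sub>R (x - y)"
    by (simp add: algebra_simps)
  have "polar y (t *\<^sub>R (x - y)) = t * polar y (x - y)"
    using linear_scale[OF bounded_linear.linear[OF bounded_linear_polar]] by simp
  moreover have "b x = b y + polar y (x - y) + b (x - y)"
    using b_add[of y "x - y"] by simp
  ultimately show ?thesis
    unfolding line b_add b_scale by (simp add: algebra_simps power2_eq_square)
qed

text \<open>In \<open>B(x, y) - B(l, y) = b x - b l - b'(y)(x - l)\<close> only the last term depends on \<open>y\<close>, and by
  symmetry of the polar form it is a bounded linear functional of \<open>y\<close>.\<close>

lemma limiting_difference_property_b: "limiting_difference_property b"
  unfolding limiting_difference_property_def
proof (intro allI impI)
  fix x l and y :: "nat \<Rightarrow> 'a"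
  assume "weakly_tendsto y l"
  then have "(\<lambda>i. Blinfun (polar (x - l)) (y i)) \<longlonglongrightarrow> Blinfun (polar (x - l)) l"
    unfolding weakly_tendsto_def by blast
  then have "(\<lambda>i. polar (x - l) (y i)) \<longlonglongrightarrow> polar (x - l) l"
    by (simp add: bounded_linear_Blinfun_apply[OF bounded_linear_polar])
  then have lim: "(\<lambda>i. b x - b l - polar (x - l) (y i)) \<longlonglongrightarrow> b x - b l - polar (x - l) l"
    by (intro tendsto_intros)
  have "divergence b x z - divergence b l z = b x - b l - polar (x - l) z" for z
    using linear_diff[OF bounded_linear.linear[OF bounded_linear_polar], of z "x - z" "l - z"]
    by (simp add: divergence_def gateaux_derivative_b polar_commute[of "x - l"])
  moreover have "divergence b x l = b x - b l - polar (x - l) l"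
    by (simp add: divergence_def gateaux_derivative_b polar_commute[of "x - l"])
  ultimately show "(\<lambda>i. divergence b x (y i) - divergence b l (y i)) \<longlonglongrightarrow> divergence b x l"
    using lim by simp
qed

end

section \<open>Coercive quadratic forms\<close>

locale coercive_quadratic_form = quadratic_form A b
    for A :: "'a::real_inner \<Rightarrow> 'a" and b +
  fixes \<mu> :: real
  assumes \<mu>_pos: "\<mu> > 0"
    and coercive: "b z \<ge> \<mu> / 2 * (norm z)\<^sup>2"
begin

lemma norm_le_sqrt_b: "norm z \<le> sqrt (2 / \<mu> * b z)"
proof (rule real_le_rsqrt)
  show "(norm z)\<^sup>2 \<le> 2 / \<mu> * b z"
    using coercive[of z] \<mu>_pos by (simp add: field_simps)
qed

lemma norm_tendsto_zero:
  assumes "(\<lambda>i. b (z i)) \<longlonglongrightarrow> 0"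
  shows "(\<lambda>i. norm (z i)) \<longlonglongrightarrow> 0"
proof (rule tendsto_sandwich[OF _ _ tendsto_const])
  have "(\<lambda>i. sqrt (2 / \<mu> * b (z i))) \<longlonglongrightarrow> sqrt (2 / \<mu> * 0)"
    by (intro tendsto_intros assms)
  then show "(\<lambda>i. sqrt (2 / \<mu> * b (z i))) \<longlonglongrightarrow> 0"
    by simp
qed (intro always_eventually allI norm_ge_zero norm_le_sqrt_b)+

lemma bounded_sublevel_right: "bounded {y. divergence b x y \<le> \<gamma>}"
proof (rule bounded_subset[OF bounded_cball])
  show "{y. divergence b x y \<le> \<gamma>} \<subseteq> cball x (sqrt (2 / \<mu> * \<gamma>))"
  proof safe
    fix y assume "divergence b x y \<le> \<gamma>"
    then have "sqrt (2 / \<mu> * b (x - y)) \<le> sqrt (2 / \<mu> * \<gamma>)"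
      using \<mu>_pos by (intro real_sqrt_le_mono mult_left_mono) (auto simp: divergence_eq)
    then show "y \<in> cball x (sqrt (2 / \<mu> * \<gamma>))"
      using norm_le_sqrt_b[of "x - y"] unfolding mem_cball dist_norm by (rule order_trans[rotated])
  qed
qed

lemma bounded_sublevel_left: "bounded {x. divergence b x y \<le> \<gamma>}"
  using bounded_sublevel_right[of y \<gamma>] by (simp add: divergence_eq b_minus_commute[of y])

lemma strongly_convex_b: "strongly_convex \<mu> b"
proof -
  have strong: "b (t *\<^sub>R x + (1 - t) *\<^sub>R y) + 1 / 2 * \<mu> * t * (1 - t) * (norm (x - y))\<^sup>2
      \<le> t * b x + (1 - t) * b y" if "t \<in> {0<..<1}" for t and x y :: 'a
  proof -
    have "t * (1 - t) * (\<mu> / 2 * (norm (x - y))\<^sup>2) \<le> t * (1 - t) * b (x - y)"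
      using that coercive by (intro mult_left_mono) auto
    then show ?thesis
      using convex_combination_gap[of t x y] by (simp add: mult_ac)
  qed
  have "convex_on UNIV b"
  proof (rule convex_onI)
    fix t :: real and x y :: 'a assume t: "0 < t" "t < 1"
    have "0 \<le> 1 / 2 * \<mu> * (1 - t) * t * (norm (x - y))\<^sup>2"
      using t \<mu>_pos by simp
    then show "b ((1 - t) *\<^sub>R x + t *\<^sub>R y) \<le> (1 - t) * b x + t * b y"
      using strong[of "1 - t" x y] t by simp
  qed simp
  then show ?thesis
    unfolding strongly_convex_def using \<mu>_pos strong by blast
qed

lemma strictly_convex_b: "strictly_convex b"
  unfolding strictly_convex_def
proof (intro allI ballI impI)
  fix x y :: 'a and t :: real assume t: "t \<in> {0<..<1}" and "x \<noteq> y"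
  then have "0 < \<mu> / 2 * (norm (x - y))\<^sup>2"
    using \<mu>_pos by simp
  then have "0 < t * (1 - t) * b (x - y)"
    using t coercive[of "x - y"] by simp
  then show "b (t *\<^sub>R x + (1 - t) *\<^sub>R y) < t * b x + (1 - t) * b y"
    using convex_combination_gap[of t x y] by linarith
qed

lemma divergence_tendsto_zeroD:
  assumes "(\<lambda>i. divergence b (x i) (y i)) \<longlonglongrightarrow> 0"
  shows "(\<lambda>i. norm (x i - y i)) \<longlonglongrightarrow> 0"
  using assms by (intro norm_tendsto_zero) (simp add: divergence_eq)

lemma sequentially_consistent_b: "sequentially_consistent b"
  unfolding sequentially_consistent_def using divergence_tendsto_zeroD by blast

lemma bregman_function_b: "bregman_function b"
  unfolding bregman_function_def
proof (intro conjI allI impI)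
  show "gateaux_differentiable b x" for x
    unfolding gateaux_differentiable_def using has_gateaux_derivative_b by blast
  show "lower_semicontinuous b"
    unfolding lower_semicontinuous_def
    using order_tendstoD(1)[OF continuous_b[unfolded continuous_at tendsto_at_iff_tendsto_nhds]]
    by blast
next
  fix x and y :: "nat \<Rightarrow> 'a"
  assume "(\<lambda>i. norm (x - y i)) \<longlonglongrightarrow> 0"
  then have "(\<lambda>i. x - y i) \<longlonglongrightarrow> 0"
    by (rule tendsto_norm_zero_cancel)
  then have "(\<lambda>i. b (x - y i)) \<longlonglongrightarrow> b 0"
    by (rule isCont_tendsto_compose[OF continuous_b])
  then show "(\<lambda>i. divergence b x (y i)) \<longlonglongrightarrow> 0"
    by (simp add: divergence_eq b_zero)
next
  fix x y :: "nat \<Rightarrow> 'a" and l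
  assume "(\<lambda>i. divergence b (x i) (y i)) \<longlonglongrightarrow> 0"
    and y: "(\<lambda>i. norm (y i - l)) \<longlonglongrightarrow> 0"
  then have "(\<lambda>i. x i - y i) \<longlonglongrightarrow> 0"
    by (intro tendsto_norm_zero_cancel[OF divergence_tendsto_zeroD])
  from tendsto_add[OF this tendsto_norm_zero_cancel[OF y]]
  have "(\<lambda>i. x i - l) \<longlonglongrightarrow> 0"
    by simp
  then show "(\<lambda>i. norm (x i - l)) \<longlonglongrightarrow> 0"
    by (rule tendsto_norm_zero)
qed (fact strictly_convex_b bounded_sublevel_right)+

end

section \<open>Quadratic entropies\<close>

theorem mainTheorem13:
  fixes A :: "'a::{real_inner, complete_space} \<Rightarrow> 'a"
    and b :: "'a \<Rightarrow> real"
    and \<mu> :: real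
  assumes "(UNIV :: 'a set) \<noteq> {0}"
    and "bounded_linear A"
    and "\<mu> > 0"
    and "\<And>x y. inner (A y - A x) (y - x) \<ge> \<mu> * (norm (x - y))\<^sup>2"
    and "\<And>x. b x = 1 / 2 * inner (A x) x"
  shows "strongly_convex \<mu> b \<and>
    sequentially_consistent b \<and> bregman_function b \<and> limiting_difference_property b \<and>
    (\<forall>y \<gamma>. bounded {x. divergence b x y \<le> \<gamma>})"
proof -
  interpret quadratic_form A b
    by (rule quadratic_form.intro) (fact assms(2,5))+
  interpret coercive_quadratic_form A b \<mu>
  proof
    show "\<mu> / 2 * (norm z)\<^sup>2 \<le> b z" for z
      using assms(4)[of z 0] A_scale[of 0 0] by (simp add: assms(5))
  qed (fact assms(3))
  show ?thesis
    using strongly_convex_b sequentially_consistent_b bregman_function_b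
      limiting_difference_property_b bounded_sublevel_left by blast
qed

end
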